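(* Let $q$ be a prime power, let $m,n$ be positive integers, and let $X$ be a vector space of dimension $n$ over $\mathbb{F}_{q^m}$. Let $\mathcal{A}=\{\langle v_1\rangle_{\mathbb{F}_{q^m}},\ldots,\langle v_s\rangle_{\mathbb{F}_{q^m}}\}$ be a partial Desarguesian $m$-spread of $X$ of size $s$ (that is, a set of $s$ distinct one-dimensional $\mathbb{F}_{q^m}$-subspaces of $X$), let $h$ be a positive integer such that $1\leq h\leq m$, and let $U$ be an $\mathbb{F}_q$-subspace of $X$ of dimension $k$ over $\mathbb{F}_q$. If $U$ is $(\mathcal{A}^{(2)},h)$-evasive, then $$s(q^m-1)+1\leq \begin{cases} q^{(mn-k)(h+1)} & \text{if } k\leq mn-m,\\ q^{m(mn-k-m+h+1)} & \text{otherwise.}\end{cases}$$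
   Context: $\mathcal{A}^{(2)}$ denotes the set of all one-dimensional $\mathbb{F}_{q^m}$-subspaces of $X$ which are contained in a space of the form $\langle v_i,v_j\rangle_{\mathbb{F}_{q^m}}$ for some $i,j\in\{1,\ldots,s\}$. For a collection $\mathcal{B}$ of $m$-dimensional $\mathbb{F}_q$-subspaces of $X$, an $\mathbb{F}_q$-subspace $U\le X$ is $(\mathcal{B},h)$-evasive if $\dim_{\mathbb{F}_q}(U\cap S)\leq h$ for all $S\in\mathcal{B}$.
   Formalization: The formal theorem requires h < m (and s ≥ 1) instead of 1 ≤ h ≤ m: for h = m every U is evasive and the bound fails, e.g. for n = s = 2, U = X, where it would read 2(q^m−1)+1 ≤ q^m. *)

theory Defs
  imports
    "HOL-Number_Theory.Prime_Powers"
    "Jordan_Normal_Form.Ring_Hom_Matrix"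
begin

text \<open>
  The fields with \<open>q\<close> and \<open>q ^ m\<close> elements are two types \<open>'k\<close> and \<open>'l\<close>, and the first is
  regarded as a subfield of the second along a field homomorphism \<open>emb\<close>. The space \<open>X\<close> is the
  type \<open>'x\<close> with scalar multiplication \<open>scale :: 'l \<Rightarrow> 'x \<Rightarrow> 'x\<close>; as a vector space over \<open>'k\<close> it
  carries the restricted scalar multiplication.
\<close>

definition restrict_scalars :: "('k \<Rightarrow> 'l) \<Rightarrow> ('l \<Rightarrow> 'x \<Rightarrow> 'x) \<Rightarrow> 'k \<Rightarrow> 'x \<Rightarrow> 'x" where
  "restrict_scalars emb scale = (\<lambda>c. scale (emb c))"

text \<open>
  Over the large field each member has dimension 1, hence dimension \<open>m\<close> over the small field;
  distinct members meet trivially.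
\<close>

definition partial_desarguesian_spread ::
    "('l::field \<Rightarrow> 'x::ab_group_add \<Rightarrow> 'x) \<Rightarrow> 'x set set \<Rightarrow> bool" where
  "partial_desarguesian_spread scale \<A> \<longleftrightarrow>
     (\<forall>S\<in>\<A>. module.subspace scale S \<and> vector_space.dim scale S = 1)"

text \<open>
  The collection \<open>\<A>\<^sup>(\<^sup>2\<^sup>)\<close> for \<open>\<A> = {\<langle>v 1\<rangle>, \<dots>, \<langle>v s\<rangle>}\<close>. The indices \<open>i\<close> and \<open>j\<close> may coincide.
\<close>

definition spread_secant_points ::
    "('l::field \<Rightarrow> 'x::ab_group_add \<Rightarrow> 'x) \<Rightarrow> (nat \<Rightarrow> 'x) \<Rightarrow> nat \<Rightarrow> 'x set set" where
  "spread_secant_points scale v s =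
     {P. module.subspace scale P \<and> vector_space.dim scale P = 1 \<and>
         (\<exists>i\<in>{1..s}. \<exists>j\<in>{1..s}. P \<subseteq> module.span scale {v i, v j})}"

text \<open>
  The members of \<open>\<B>\<close> are meant to have a common dimension \<open>m\<close>. If \<open>h = m\<close>, the bound on the
  intersections is satisfied by every subspace \<open>U\<close>, and the size bound for partial spreads then
  fails (take \<open>U\<close> the whole space and \<open>s = n = 2\<close>); so \<open>h \<noteq> m\<close> has to be required there.
\<close>

definition evasive ::
    "('k::field \<Rightarrow> 'x::ab_group_add \<Rightarrow> 'x) \<Rightarrow> 'x set set \<Rightarrow> nat \<Rightarrow> 'x set \<Rightarrow> bool" where
  "evasive scale \<B> h U \<longleftrightarrow>
     module.subspace scale U \<and> (\<forall>S\<in>\<B>. vector_space.dim scale (U \<inter> S) \<le> h)"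

end

theory Submission
  imports Defs "HOL-Library.Cardinality"
begin

text \<open>
  Choose a subspace \<open>W \<supseteq> U\<close> over the small field, and a set \<open>T\<close> of scalars in the large field that
  is independent over the small one, and send \<open>x\<close> to the family of the cosets \<open>t x + W\<close> with
  \<open>t \<in> T\<close>. If \<open>x \<noteq> y\<close> in the union of the spread have the same image, then \<open>W\<close> contains
  \<open>(span T) (x - y)\<close>, which has dimension \<open>|T|\<close> and lies in a point of \<open>\<A>\<^sup>(\<^sup>2\<^sup>)\<close>. For \<open>W = U\<close>
  and \<open>|T| = h + 1\<close> this contradicts evasiveness. It also does for \<open>|T| = m\<close> and
  \<open>dim W = k + m - h - 1\<close>, since \<open>W\<close> then contains the whole point, which so meets \<open>U\<close> in dimension
  at least \<open>h + 1\<close>; this is the puncturing argument of the Singleton bound for rank-metric codes.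
  Counting families of cosets gives the two bounds.
\<close>

section \<open>Cardinality and dimension over a finite field\<close>

lemma (in vector_space) card_span_independent:
  assumes "finite (UNIV :: 'a set)" "finite B" "independent B"
  shows "card (span B) = CARD('a) ^ card B"
proof -
  let ?f = "\<lambda>u. \<Sum>b\<in>B. u b *s b"
  have im: "?f ` (B \<rightarrow>\<^sub>E UNIV) = span B"
  proof -
    \<comment> \<open>Values of \<open>u\<close> outside \<open>B\<close> do not enter the sum, so
      passing to extensional functions loses no vector; only for these are the coefficients
      unique.\<close>
    have "?f u \<in> ?f ` (B \<rightarrow>\<^sub>E UNIV)" for u
      by (rule image_eqI[of _ _ "restrict u B"]) (auto intro: sum.cong)
    then have "range ?f \<subseteq> ?f ` (B \<rightarrow>\<^sub>E UNIV)"
      by blast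
    then show ?thesis
      using span_finite[OF assms(2)] by auto
  qed
  have "inj_on ?f (B \<rightarrow>\<^sub>E UNIV)"
  proof (rule inj_onI)
    fix u w assume uw: "u \<in> B \<rightarrow>\<^sub>E UNIV" "w \<in> B \<rightarrow>\<^sub>E UNIV" "?f u = ?f w"
    then have "(\<Sum>b\<in>B. (u b - w b) *s b) = 0"
      by (simp add: scale_left_diff_distrib sum_subtractf)
    then have "u b = w b" if "b \<in> B" for b
      using independentD[OF assms(3,2) subset_refl, of "\<lambda>b. u b - w b"] that by simp
    then show "u = w"
      using uw by (intro PiE_ext)
  qed
  then have "card (span B) = card (B \<rightarrow>\<^sub>E (UNIV :: 'a set))"
    unfolding im[symmetric] by (rule card_image)
  then show ?thesis
    using assms(2) by (simp add: card_PiE)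
qed

lemma (in vector_space) card_subspace:
  assumes "finite (UNIV :: 'a set)" "finite S" "subspace S"
  shows "card S = CARD('a) ^ dim S"
proof -
  obtain B where B: "B \<subseteq> S" "independent B" "S \<subseteq> span B" "card B = dim S"
    using basis_exists by blast
  then have "span B = S"
    using assms(3) by (simp add: span_minimal subset_antisym)
  then show ?thesis
    using card_span_independent[of B] B assms finite_subset by metis
qed

text \<open>An infinite basis has \<open>card\<close> 0, so positive \<open>dim\<close> forces a
  finite basis, and there are only finitely many linear combinations of it.\<close>

lemma (in vector_space) finite_UNIV_of_dim_pos:
  assumes "finite (UNIV :: 'a set)" "dim UNIV > 0"
  shows "finite (UNIV :: 'b set)"
proof -
  obtain B where B: "independent B" "UNIV \<subseteq> span B" "card B = dim UNIV"
    using basis_exists by blast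
  then have "finite B"
    using assms(2) by (simp add: card_ge_0_finite)
  then have "card (span B) > 0"
    using card_span_independent[OF assms(1) _ B(1)] assms(1) by (simp add: finite_UNIV_card_ge_0)
  then have "finite (span B)"
    by (rule card_ge_0_finite)
  then show ?thesis
    using B(2) by (rule rev_finite_subset)
qed

text \<open>Gives access to the locale in which dimensions are monotone and the dimension formula
  for sums and intersections holds.\<close>

lemma (in vector_space) finite_dimensional_of_finite:
  assumes "finite (UNIV :: 'b set)"
  obtains B where "finite_dimensional_vector_space scale B"
proof -
  obtain B where B: "independent B" "UNIV \<subseteq> span B"
    using basis_exists by blast
  show ?thesis
  proof
    show "finite_dimensional_vector_space scale B"
      using B subset_UNIV[THEN finite_subset, OF assms] by unfold_locales auto
  qed
qed

section \<open>Counting cosets and families of cosets\<close>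

lemma (in vector_space) card_range_cosets:
  assumes "finite (UNIV :: 'b set)" "subspace W"
  shows "card W * card (range (\<lambda>x. (+) x ` W)) = CARD('b)"
proof -
  have coset_eq: "(+) x ` W = (+) y ` W" if "x - y \<in> W" for x y
  proof -
    have "(+) x ` W \<subseteq> (+) y ` W" if "x - y \<in> W" for x y
    proof
      fix z assume "z \<in> (+) x ` W"
      then obtain w where "w \<in> W" "z = x + w" by auto
      then have "z = y + ((x - y) + w)" "(x - y) + w \<in> W"
        using that subspace_add[OF assms(2)] by auto
      then show "z \<in> (+) y ` W" by blast
    qed
    moreover have "y - x \<in> W"
      using subspace_neg[OF assms(2) that] by simp
    ultimately show ?thesis using that by blast
  qed
  have disj: "(+) x ` W = (+) y ` W" if meet: "(+) x ` W \<inter> (+) y ` W \<noteq> {}" for x y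
  proof -
    obtain a b where "a \<in> W" "b \<in> W" "x + a = y + b" using meet by blast
    then have "x - y = b - a" "b - a \<in> W"
      using subspace_diff[OF assms(2)] by (auto simp: algebra_simps)
    then show ?thesis using coset_eq by simp
  qed
  have "\<Union> (range (\<lambda>x. (+) x ` W)) = UNIV"
    using subspace_0[OF assms(2)] by (auto intro!: image_eqI[of _ "(+) _" 0])
  moreover have "card W * card (range (\<lambda>x. (+) x ` W)) = card (\<Union> (range (\<lambda>x. (+) x ` W)))"
    using assms(1) disj
    by (intro card_partition) (auto intro: finite_subset[OF subset_UNIV] card_image)
  ultimately show ?thesis by simp
qed

text \<open>By \<open>sep\<close>, the family of cosets of \<open>f t x\<close> for \<open>t\<close>
  in \<open>T\<close> determines \<open>x\<close> within \<open>C\<close>. The map \<open>f\<close>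
  stands for multiplication by scalars of the large field: the locale is meant for the small field,
  where these are not scalars.\<close>

lemma (in vector_space) card_le_cosets_power:
  assumes "finite (UNIV :: 'b set)" "subspace W" "finite T"
    and diff: "\<And>t x y. f t (x - y) = f t x - (f t y :: 'b)"
    and sep: "\<And>x y. x \<in> C \<Longrightarrow> y \<in> C \<Longrightarrow> x \<noteq> y \<Longrightarrow> \<exists>t\<in>T. f t (x - y) \<notin> W"
  shows "card C \<le> card (range (\<lambda>x. (+) x ` W)) ^ card T"
proof -
  let ?Q = "range (\<lambda>x. (+) x ` W)"
  let ?g = "\<lambda>x. \<lambda>t\<in>T. (+) (f t x) ` W"
  have "finite ?Q" using assms(1) by simp
  have same: "x - y \<in> W" if eq: "(+) x ` W = (+) y ` W" for x y
  proof -
    have "x \<in> (+) x ` W" using subspace_0[OF assms(2)] by force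
    then obtain w where "w \<in> W" "x = y + w" using eq by auto
    then show ?thesis by simp
  qed
  have "inj_on ?g C"
  proof (rule inj_onI, rule ccontr)
    fix x y assume "x \<in> C" "y \<in> C" and eq: "?g x = ?g y" and "x \<noteq> y"
    then obtain t where t: "t \<in> T" "f t (x - y) \<notin> W" using sep by blast
    then have "(+) (f t x) ` W = (+) (f t y) ` W"
      using fun_cong[OF eq, of t] by simp
    then show False using same t(2) diff by simp
  qed
  moreover have "?g ` C \<subseteq> T \<rightarrow>\<^sub>E ?Q" by auto
  moreover have "finite (T \<rightarrow>\<^sub>E ?Q)"
    using \<open>finite T\<close> \<open>finite ?Q\<close> by (simp add: finite_PiE)
  ultimately have "card C \<le> card (T \<rightarrow>\<^sub>E ?Q)"
    by (intro card_inj_on_le)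
  then show ?thesis
    using \<open>finite T\<close> by (simp add: card_PiE)
qed

section \<open>Lines, superspaces and scalars of the large field\<close>

lemma vector_space_restrict_scalars:
  assumes "field_hom emb" "vector_space scale"
  shows "vector_space (restrict_scalars emb scale)"
proof -
  interpret field_hom emb by fact
  interpret vector_space scale by fact
  show ?thesis
    by unfold_locales
      (simp_all add: restrict_scalars_def hom_add hom_mult scale_right_distrib scale_left_distrib)
qed

lemma (in vector_space) dim_span_singleton:
  assumes "z \<noteq> 0"
  shows "dim (span {z}) = 1"
proof -
  have "dim (span {z}) = card {z}"
    by (rule dim_span_eq_card_independent) (use assms in simp)
  then show ?thesis by simp
qed

text \<open>A nonzero vector spans every line containing it, so the lines without 0 are disjoint;
  the final 1 counts the zero vector.\<close>

lemma (in vector_space) card_Union_lines: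
  assumes fin: "finite (UNIV :: 'a set)" "finite (UNIV :: 'b set)" "\<A> \<noteq> {}"
    and lines: "\<And>S. S \<in> \<A> \<Longrightarrow> subspace S \<and> dim S = 1"
  shows "card (\<Union>\<A>) = card \<A> * (CARD('a) - 1) + 1"
proof -
  have finS: "finite S" for S :: "'b set"
    using subset_UNIV fin(2) by (rule finite_subset)
  have cardS: "card S = CARD('a)" if "subspace S" "dim S = 1" for S
    using card_subspace[OF fin(1) finS that(1)] that(2) by simp
  have span_eq: "span {z} = S" if "S \<in> \<A>" "z \<in> S" "z \<noteq> 0" for S z
  proof (rule card_subset_eq[OF finS])
    show "span {z} \<subseteq> S"
      using that(1,2) lines by (intro span_minimal) auto
    show "card (span {z}) = card S"
      using cardS[of S] cardS[OF subspace_span dim_span_singleton] lines that by metis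
  qed
  have "card (\<Union>S\<in>\<A>. S - {0}) = (\<Sum>S\<in>\<A>. card (S - {0}))"
  proof (rule card_UN_disjoint)
    show "finite \<A>"
      using fin(2) by (metis Pow_UNIV finite_Pow_iff finite_subset subset_UNIV)
    show "\<forall>S\<in>\<A>. \<forall>S'\<in>\<A>. S \<noteq> S' \<longrightarrow> (S - {0}) \<inter> (S' - {0}) = {}"
    proof (intro ballI impI)
      fix S S' assume S: "S \<in> \<A>" "S' \<in> \<A>" "S \<noteq> S'"
      have False if "z \<in> S" "z \<in> S'" "z \<noteq> 0" for z
        using span_eq[of S z] span_eq[of S' z] S that by simp
      then show "(S - {0}) \<inter> (S' - {0}) = {}"
        by blast
    qed
  qed (simp add: finS)
  also have "\<dots> = (\<Sum>S\<in>\<A>. CARD('a) - 1)"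
  proof (rule sum.cong)
    fix S assume "S \<in> \<A>"
    then show "card (S - {0}) = CARD('a) - 1"
      using lines cardS subspace_0 by (subst card_Diff_singleton) auto
  qed simp
  finally have "card (\<Union>S\<in>\<A>. S - {0}) = card \<A> * (CARD('a) - 1)"
    by simp
  moreover have "\<Union>\<A> = insert 0 (\<Union>S\<in>\<A>. S - {0})"
    using fin(3) lines subspace_0 by auto
  moreover have "card (insert 0 (\<Union>S\<in>\<A>. S - {0})) = card (\<Union>S\<in>\<A>. S - {0}) + 1"
    by (subst card_insert_disjoint[OF finS]) auto
  ultimately show ?thesis
    by (simp only:)
qed

text \<open>Extend a basis of \<open>U\<close> to one of the whole space and span a set of
  \<open>d\<close> elements between the two.\<close>

lemma (in finite_dimensional_vector_space) exists_superspace_of_dim: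
  assumes "subspace U" "dim U \<le> d" "d \<le> dim UNIV"
  obtains W where "subspace W" "U \<subseteq> W" "dim W = d"
proof -
  obtain B where B: "B \<subseteq> U" "independent B" "U \<subseteq> span B" "card B = dim U"
    using basis_exists by blast
  obtain D where D: "B \<subseteq> D" "independent D" "UNIV \<subseteq> span D"
    using maximal_independent_subset_extend[OF subset_UNIV B(2)] by metis
  have "finite D" using D(2) by (rule finiteI_independent)
  moreover have "card D = dim UNIV" using basis_card_eq_dim[of D UNIV] D by simp
  ultimately obtain E where E: "B \<subseteq> E" "E \<subseteq> D" "card E = d"
    using exists_subset_between[of B d D] D(1) B(4) assms(2,3) by metis
  then have "independent E" using D(2) independent_mono by blast
  show ?thesis
  proof
    show "subspace (span E)" by simp
    show "U \<subseteq> span E" using B(3) span_mono[OF E(1)] by blast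
    show "dim (span E) = d" using \<open>independent E\<close> E(3) dim_span_eq_card_independent by simp
  qed
qed

text \<open>The scalars \<open>a\<close> with \<open>a z\<close> in \<open>W\<close> form a subspace
  of the large field over the small one. If it contained \<open>T\<close>, it would contain the span
  of \<open>T\<close>, which \<open>a \<mapsto> a z\<close> embeds into
  \<open>W \<inter> \<langle>z\<rangle>\<close>; that set is too small.\<close>

lemma exists_scale_notin:
  fixes emb :: "'k::field \<Rightarrow> 'l::field" and scale :: "'l \<Rightarrow> 'x::ab_group_add \<Rightarrow> 'x"
  assumes emb: "field_hom emb" and X: "vector_space scale"
    and fin: "finite (UNIV :: 'k set)" "finite (UNIV :: 'x set)" "finite T"
    and W: "module.subspace (restrict_scalars emb scale) W"
    and T: "\<not> module.dependent (restrict_scalars emb (*)) T"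
    and z: "z \<noteq> 0" "card (W \<inter> module.span scale {z}) < CARD('k) ^ card T"
  shows "\<exists>t\<in>T. scale t z \<notin> W"
proof (rule ccontr)
  assume neg: "\<not> ?thesis"
  interpret L: vector_space scale by fact
  interpret K: vector_space "restrict_scalars emb scale"
    using emb X by (rule vector_space_restrict_scalars)
  interpret F: vector_space "restrict_scalars emb ((*) :: 'l \<Rightarrow> 'l \<Rightarrow> 'l)"
    using emb by (rule vector_space_restrict_scalars) (unfold_locales, simp_all add: algebra_simps)
  have "F.subspace {a. scale a z \<in> W}"
    using K.subspace_0[OF W] K.subspace_add[OF W] K.subspace_scale[OF W]
    by (intro F.subspaceI)
      (simp_all add: restrict_scalars_def L.scale_left_distrib flip: L.scale_scale)
  then have "F.span T \<subseteq> {a. scale a z \<in> W}"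
    using neg by (intro F.span_minimal) auto
  then have "(\<lambda>a. scale a z) ` F.span T \<subseteq> W \<inter> L.span {z}"
    by (auto intro: L.span_scale L.span_base)
  moreover have "inj_on (\<lambda>a. scale a z) (F.span T)"
    using z(1) by (auto intro: inj_onI)
  ultimately have "card (F.span T) \<le> card (W \<inter> L.span {z})"
    using fin(2) by (meson card_inj_on_le finite_subset subset_UNIV)
  then show False
    using z(2) F.card_span_independent[OF fin(1,3) T] by simp
qed

section \<open>From evasiveness to the two bounds\<close>

theorem corollary3p14:
  fixes emb :: "'k::field \<Rightarrow> 'l::field"
    and scale :: "'l \<Rightarrow> 'x::ab_group_add \<Rightarrow> 'x"
    and q m n s h k :: nat
    and v :: "nat \<Rightarrow> 'x"
    and \<A> :: "'x set set"
    and U :: "'x set"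
  assumes q: "primepow q"
    and m: "m \<ge> 1" and n: "n \<ge> 1"
    and card_k: "card (UNIV :: 'k set) = q" and card_l: "card (UNIV :: 'l set) = q ^ m"
    and emb: "field_hom emb"
    and X: "vector_space scale" "vector_space.dim scale UNIV = n"
    and spread: "partial_desarguesian_spread scale \<A>"
    and \<A>: "\<A> = (\<lambda>i. module.span scale {v i}) ` {1..s}" "card \<A> = s" "s \<ge> 1"
    and h: "1 \<le> h" "h \<le> m" "h \<noteq> m"
    and U: "module.subspace (restrict_scalars emb scale) U"
           "vector_space.dim (restrict_scalars emb scale) U = k"
    and evasive: "evasive (restrict_scalars emb scale) (spread_secant_points scale v s) h U"
  shows "real s * (real q ^ m - 1) + 1 \<le>
    (if int k \<le> int m * int n - int m
     then real q powi ((int m * int n - int k) * (int h + 1))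
     else real q powi (int m * (int m * int n - int k - int m + int h + 1)))"
proof -
  interpret L: vector_space scale by fact
  interpret F: vector_space "restrict_scalars emb ((*) :: 'l \<Rightarrow> 'l \<Rightarrow> 'l)"
    using emb by (rule vector_space_restrict_scalars) (unfold_locales, simp_all add: algebra_simps)
  have q1: "q > 1" using q primepow_gt_Suc_0 by fastforce
  have fk: "finite (UNIV :: 'k set)" using card_k q1 by (intro card_ge_0_finite) simp
  have fl: "finite (UNIV :: 'l set)" using card_l q1 by (intro card_ge_0_finite) simp
  have fx: "finite (UNIV :: 'x set)" using L.finite_UNIV_of_dim_pos[OF fl] X(2) n by simp
  have fs: "finite S" for S :: "'x set" using subset_UNIV fx by (rule finite_subset)
  obtain B where "finite_dimensional_vector_space (restrict_scalars emb scale) B"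
    using vector_space.finite_dimensional_of_finite[OF vector_space_restrict_scalars[OF emb X(1)] fx]
    by blast
  then interpret K: finite_dimensional_vector_space "restrict_scalars emb scale" B .
  have cardK: "card S = q ^ K.dim S" if "K.subspace S" for S
    using K.card_subspace[OF fk fs that] card_k by simp
  have cardX: "CARD('x) = q ^ (m * n)"
    using L.card_subspace[OF fl fx] card_l X(2) by (simp add: power_mult)
  then have dimX: "K.dim UNIV = m * n"
    using cardK[of UNIV] q1 by simp
  have LK: "K.subspace S" if "L.subspace S" for S
    using L.subspace_0[OF that] L.subspace_add[OF that] L.subspace_scale[OF that]
    by (intro K.subspaceI) (simp_all add: restrict_scalars_def)
  have dim_line: "K.dim S = m" if "L.subspace S" "L.dim S = 1" for S
    using cardK[OF LK[OF that(1)]] L.card_subspace[OF fl fs that(1)] that(2) card_l q1 by simp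
  have lines: "L.subspace S \<and> L.dim S = 1" if "S \<in> \<A>" for S
    using spread that unfolding partial_desarguesian_spread_def by blast
  define C where "C = \<Union>\<A>"
  have "\<A> \<noteq> {}" using \<A>(1,3) by auto
  then have cardC: "card C = s * (q ^ m - 1) + 1"
    unfolding C_def using L.card_Union_lines[OF fl fx _ lines] card_l \<A>(2) by simp
  have ev: "K.dim (U \<inter> P) \<le> h" if "P \<in> spread_secant_points scale v s" for P
    using evasive that unfolding evasive_def by blast
  \<comment> \<open>\<open>C\<close> is not closed under subtraction, but a difference of vectors
    from two spread lines stays in the span of these lines.\<close>
  have secant: "L.span {x - y} \<in> spread_secant_points scale v s"
    if xy: "x \<in> C" "y \<in> C" "x \<noteq> y" for x y
  proof -
    obtain i j where ij: "i \<in> {1..s}" "j \<in> {1..s}" "x \<in> L.span {v i}" "y \<in> L.span {v j}"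
      using xy(1,2) unfolding C_def \<A>(1) by blast
    then have "x \<in> L.span {v i, v j}" "y \<in> L.span {v i, v j}"
      using L.span_mono[of "{v i}" "{v i, v j}"] L.span_mono[of "{v j}" "{v i, v j}"] by blast+
    then have "L.span {x - y} \<subseteq> L.span {v i, v j}"
      by (intro L.span_minimal) (simp_all add: L.span_diff)
    then have "\<exists>i\<in>{1..s}. \<exists>j\<in>{1..s}. L.span {x - y} \<subseteq> L.span {v i, v j}"
      using ij(1,2) by blast
    moreover have "L.dim (L.span {x - y}) = 1"
      using xy(3) by (intro L.dim_span_singleton) simp
    ultimately show ?thesis
      unfolding spread_secant_points_def by blast
  qed
  \<comment> \<open>Common form of both cases: there are \<open>q ^ (m * n - K.dim W)\<close> cosets
    of \<open>W\<close>, and \<open>small\<close> leaves no room in a secant point for all multiples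
    of a nonzero difference by the span of \<open>T\<close>.\<close>
  have bound: "card C \<le> q ^ ((m * n - K.dim W) * card T)"
    if W: "K.subspace W" and T: "F.independent T" "finite T"
      and small: "\<And>P. P \<in> spread_secant_points scale v s \<Longrightarrow> K.dim (W \<inter> P) < card T" for W T
  proof -
    have "card C \<le> card (range (\<lambda>x. (+) x ` W)) ^ card T"
    proof (rule K.card_le_cosets_power[OF fx W T(2), where f = scale])
      fix x y assume xy: "x \<in> C" "y \<in> C" "x \<noteq> y"
      have "L.subspace (L.span {x - y})" by simp
      then have "card (W \<inter> L.span {x - y}) < CARD('k) ^ card T"
        using cardK[of "W \<inter> L.span {x - y}"] K.subspace_inter[OF W LK] small[OF secant[OF xy]]
          q1 card_k by simp
      then show "\<exists>t\<in>T. scale t (x - y) \<notin> W"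
        using exists_scale_notin[OF emb X(1) fk fx T(2) W T(1)] xy(3) by simp
    qed (rule L.scale_right_diff_distrib)
    moreover have "card (range (\<lambda>x. (+) x ` W)) = q ^ (m * n - K.dim W)"
    proof -
      have "q ^ K.dim W * card (range (\<lambda>x. (+) x ` W)) = q ^ (m * n)"
        using K.card_range_cosets[OF fx W] cardK[OF W] cardX by simp
      also have "\<dots> = q ^ K.dim W * q ^ (m * n - K.dim W)"
        using K.dim_subset[OF subset_UNIV, of W] dimX by (simp flip: power_add)
      finally show ?thesis using q1 by simp
    qed
    ultimately show ?thesis by (simp add: power_mult)
  qed
  \<comment> \<open>A basis of the large field over the small one: the source of \<open>T\<close> in
    the first case, and \<open>T\<close> itself in the second.\<close>
  obtain D where D: "F.independent D" "UNIV \<subseteq> F.span D"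
    using F.basis_exists by blast
  have "finite D" using subset_UNIV fl by (rule finite_subset)
  have "card D = m"
    using F.card_span_independent[OF fk \<open>finite D\<close> D(1)] top.extremum_uniqueI[OF D(2)]
      card_k card_l q1 by simp
  have k: "k \<le> m * n"
    using K.dim_subset[OF subset_UNIV, of U] dimX U(2) by simp
  have real_card: "real (card C) = real s * (real q ^ m - 1) + 1"
    using cardC q1 by simp
  \<comment> \<open>The dimension formula for \<open>U\<close> and
    \<open>\<langle>v 1\<rangle>\<close>, a secant point with \<open>i = j = 1\<close>. It ensures
    that the superspace \<open>W\<close> of the second case fits into the whole space.\<close>
  have km: "k + m \<le> m * n + h"
  proof -
    let ?P = "L.span {v 1}"
    have P: "?P \<in> \<A>" using \<A>(1,3) by auto
    then have "?P \<in> spread_secant_points scale v s"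
      using \<A>(3) lines unfolding spread_secant_points_def by force
    then have "K.dim (U \<inter> ?P) \<le> h" by (rule ev)
    moreover have "K.dim ?P = m" using P lines dim_line by blast
    moreover have "K.dim {x + y |x y. x \<in> U \<and> y \<in> ?P} \<le> m * n"
      using K.dim_subset[OF subset_UNIV] dimX by simp
    ultimately show ?thesis
      using K.dim_sums_Int[OF U(1) LK[of ?P]] U(2) by simp
  qed
  show ?thesis
  proof (cases "int k \<le> int m * int n - int m")
    case True
    \<comment> \<open>Since \<open>h < m\<close>, the basis \<open>D\<close> has at least
      \<open>h + 1\<close> elements.\<close>
    obtain T where T: "T \<subseteq> D" "card T = h + 1" "finite T"
      using obtain_subset_with_card_n[of "h + 1" D] h \<open>card D = m\<close> by force
    then have "card C \<le> q ^ ((m * n - k) * (h + 1))"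
      using bound[OF U(1) F.independent_mono[OF D(1) T(1)] T(3)] ev U(2) by (simp add: less_Suc_eq_le)
    then have "real (card C) \<le> real q ^ ((m * n - k) * (h + 1))"
      by (metis of_nat_le_iff of_nat_power)
    also have "\<dots> = real q powi int ((m * n - k) * (h + 1))"
      by (simp only: power_int_of_nat)
    also have "int ((m * n - k) * (h + 1)) = (int m * int n - int k) * (int h + 1)"
      using k by (simp only: of_nat_mult of_nat_add of_nat_diff of_nat_1)
    finally show ?thesis using True real_card by simp
  next
    case False
    \<comment> \<open>A secant point \<open>P\<close> meets \<open>U\<close> in dimension at most
      \<open>h\<close>, so \<open>U + P\<close> has dimension at least \<open>k + m - h\<close>. One
      less is the largest dimension at which this count keeps \<open>P\<close> from lying in
      \<open>W\<close>.\<close>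
    obtain W where W: "K.subspace W" "U \<subseteq> W" "K.dim W = k + (m - h - 1)"
    proof (rule K.exists_superspace_of_dim[OF U(1)])
      show "K.dim U \<le> k + (m - h - 1)" using U(2) by simp
      show "k + (m - h - 1) \<le> K.dim UNIV" using km h dimX by simp
    qed
    \<comment> \<open>By \<open>km\<close> and \<open>h < m\<close> no subtraction of naturals is
      truncated here.\<close>
    have "int (m * n - (k + (m - h - 1))) = int m * int n - int k - int m + int h + 1"
      using km h by simp
    then have exponent: "int ((m * n - (k + (m - h - 1))) * m) =
        int m * (int m * int n - int k - int m + int h + 1)"
      by (simp only: of_nat_mult mult.commute)
    \<comment> \<open>Otherwise \<open>P\<close> lies in \<open>W\<close>, hence so does
      \<open>U + P\<close>, against the choice of the dimension of \<open>W\<close>.\<close>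
    have "K.dim (W \<inter> P) < card D" if P: "P \<in> spread_secant_points scale v s" for P
    proof (rule ccontr)
      assume "\<not> ?thesis"
      moreover have P': "K.subspace P" "K.dim P = m"
        using P dim_line LK unfolding spread_secant_points_def by auto
      ultimately have "W \<inter> P = P"
        using K.subspace_dim_equal[of "W \<inter> P" P] K.subspace_inter[OF W(1)] \<open>card D = m\<close> by simp
      then have "{x + y |x y. x \<in> U \<and> y \<in> P} \<subseteq> W"
        using W(2) K.subspace_add[OF W(1)] by blast
      then have "K.dim {x + y |x y. x \<in> U \<and> y \<in> P} \<le> k + (m - h - 1)"
        unfolding W(3)[symmetric] by (rule K.dim_subset)
      then show False
        using K.dim_sums_Int[OF U(1) P'(1)] ev[OF P] P'(2) U(2) h by simp
    qed
    then have "card C \<le> q ^ ((m * n - (k + (m - h - 1))) * m)"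
      using bound[OF W(1) D(1) \<open>finite D\<close>] W(3) \<open>card D = m\<close> by simp
    then have "real (card C) \<le> real q ^ ((m * n - (k + (m - h - 1))) * m)"
      by (metis of_nat_le_iff of_nat_power)
    also have "\<dots> = real q powi (int m * (int m * int n - int k - int m + int h + 1))"
      unfolding exponent[symmetric] by (simp only: power_int_of_nat)
    finally show ?thesis using False real_card by simp
  qed
qed

end
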